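(* Let $\{(X_k,\mathfrak X_k)\}_{k\in\mathbb N_0}$ be any family of measurable spaces and, for each $k\in\mathbb N_0$, let $\tilde{\mathfrak X}_k\subseteq\mathfrak X_k$ be a sub-$\sigma$-algebra. For $n\in\mathbb N_0$ denote by $(\Omega_n,\mathcal F_n)=\prod_{k=0}^n(X_k,\mathfrak X_k)$ and $(\Omega_n,\tilde{\mathcal F}_n)=\prod_{k=0}^n(X_k,\tilde{\mathfrak X}_k)$ the corresponding product measurable spaces. Let $P^0\in\mathcal P(X_0,\mathfrak X_0)$ and $\tilde P^0\in\mathcal P(X_0,\tilde{\mathfrak X}_0)$, and for $k\in\mathbb N$ let $P^k:\Omega_{k-1}\to\mathcal P(X_k,\mathfrak X_k)$ and $\tilde P^k:\Omega_{k-1}\to\mathcal P(X_k,\tilde{\mathfrak X}_k)$ be stochastic kernels that are $\mathcal F_{k-1}$-measurable and $\tilde{\mathcal F}_{k-1}$-measurable, respectively. Let $\mathsf P^n:=\bigotimes_{k=0}^nP^k\in\mathcal P(\Omega_n,\mathcal F_n)$ and $\tilde{\mathsf P}^n:=\bigotimes_{k=0}^n\tilde P^k\in\mathcal P(\Omega_n,\tilde{\mathcal F}_n)$. If a sequence of reals $(c_k)_{k\in\mathbb N_0}$ is such that $\|P^k-\tilde P^k\|\le c_k$ for all $k\in\mathbb N_0$, then for any $n\in\mathbb N_0$ $$\|\mathsf P^n-\tilde{\mathsf P}^n\|\le\sum_{k=0}^nc_k .$$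
   Context: $\mathbb N_0=\mathbb N\cup\{0\}$, where $\mathbb N=\{1,2,\dots\}$. $\mathcal P(X,\mathfrak X)$ is the set of probability measures on a measurable space $(X,\mathfrak X)$. A stochastic kernel $K:X\to\mathcal P(Y,\mathfrak Y)$, $x\mapsto K_x$, that is $\mathfrak X$-measurable is a map such that $x\mapsto K_x(A)$ is $\mathfrak X$-measurable for every $A\in\mathfrak Y$. Product of a measure and a kernel: for $\mu\in\mathcal P(X,\mathfrak X)$ and an $\mathfrak X$-measurable stochastic kernel $K:X\to\mathcal P(Y,\mathfrak Y)$, $\mu\otimes K$ is the unique probability measure on $(X\times Y,\mathfrak X\otimes\mathfrak Y)$ with $(\mu\otimes K)(A\times B)=\int_AK_x(B)\,\mu(dx)$ for all $A\in\mathfrak X$, $B\in\mathfrak Y$. Inductively, $\bigotimes_{k=0}^0P^k=P^0$ and $\bigotimes_{k=0}^{n+1}P^k=\left(\bigotimes_{k=0}^nP^k\right)\otimes P^{n+1}$. Total variation: for a finite signed measure $\nu$ on $(X,\mathfrak X)$ with Hahn-Jordan decomposition $\nu=\nu^+-\nu^-$, $\|\nu\|=\nu^+(X)+\nu^-(X)$; for a kernel $K$ from $X$ to finite signed measures on $(Y,\mathfrak Y)$, $\|K\|=\sup_{x\in X}\|K_x\|$. Convention: if the domain ($\sigma$-algebra) of one measure is a subset of the domain of another, the total variation distance between them is taken over the smaller domain. Thus $\|P^0-\tilde P^0\|=2\sup_{A\in\tilde{\mathfrak X}_0}|P^0(A)-\tilde P^0(A)|$, $\|P^k-\tilde P^k\|=2\sup_{\omega\in\Omega_{k-1}}\sup_{A\in\tilde{\mathfrak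 X}_k}|P^k_\omega(A)-\tilde P^k_\omega(A)|$ for $k\in\mathbb N$, and $\|\mathsf P^n-\tilde{\mathsf P}^n\|=2\sup_{A\in\tilde{\mathcal F}_n}|\mathsf P^n(A)-\tilde{\mathsf P}^n(A)|$. *)

theory Defs
  imports "HOL-Probability.Probability"
begin

text \<open>
  The total variation norm of a finite signed measure \<open>\<nu>\<close> on the \<open>\<sigma>\<close>-algebra of \<open>N\<close>; only
  \<open>space N\<close> and \<open>sets N\<close> matter. With a Hahn decomposition \<open>(S, space N - S)\<close> the Jordan parts are
  \<open>\<nu>\<^sup>+ A = \<nu> (A \<inter> S)\<close> and \<open>\<nu>\<^sup>- A = - \<nu> (A - S)\<close>.
\<close>

definition Hahn_set :: "'a measure \<Rightarrow> ('a set \<Rightarrow> real) \<Rightarrow> 'a set \<Rightarrow> bool" where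
  "Hahn_set N \<nu> S \<longleftrightarrow> S \<in> sets N \<and>
     (\<forall>A\<in>sets N. A \<subseteq> S \<longrightarrow> 0 \<le> \<nu> A) \<and>
     (\<forall>A\<in>sets N. A \<subseteq> space N - S \<longrightarrow> \<nu> A \<le> 0)"

definition tv_norm :: "'a measure \<Rightarrow> ('a set \<Rightarrow> real) \<Rightarrow> real" where
  "tv_norm N \<nu> = (THE v. \<exists>S. Hahn_set N \<nu> S \<and> v = \<nu> S + - \<nu> (space N - S))"

text \<open>
  The distance of \<open>\<mu>\<close> and \<open>\<mu>'\<close> over the \<open>\<sigma>\<close>-algebra of \<open>N\<close>, which is meant to be the smaller of
  the two domains.
\<close>

definition tv_dist :: "'a measure \<Rightarrow> 'a measure \<Rightarrow> 'a measure \<Rightarrow> real" where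
  "tv_dist N \<mu> \<mu>' = tv_norm N (\<lambda>A. measure \<mu> A - measure \<mu>' A)"

text \<open>
  For probability kernels over a nonempty space this is the supremum of a nonempty set of reals
  bounded by \<open>2\<close>, so the conditionally complete \<open>SUP\<close> on the reals is the right one.
\<close>

definition kernel_tv_dist ::
  "'b measure \<Rightarrow> 'a measure \<Rightarrow> ('b \<Rightarrow> 'a measure) \<Rightarrow> ('b \<Rightarrow> 'a measure) \<Rightarrow> real" where
  "kernel_tv_dist M N K K' = (SUP \<omega>\<in>space M. tv_dist N (K \<omega>) (K' \<omega>))"

definition kernel_prod :: "'a measure \<Rightarrow> 'b measure \<Rightarrow> ('a \<Rightarrow> 'b measure) \<Rightarrow> ('a \<times> 'b) measure" where
  "kernel_prod \<mu> N K = (THE R. prob_space R \<and> sets R = sets (\<mu> \<Otimes>\<^sub>M N) \<and>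
     (\<forall>A\<in>sets \<mu>. \<forall>B\<in>sets N. emeasure R (A \<times> B) = (\<integral>\<^sup>+x\<in>A. emeasure (K x) B \<partial>\<mu>)))"

text \<open>
  The spaces \<open>X k\<close> have a common element type but arbitrary carriers \<open>space (X k)\<close>. A
  \<open>'a measure\<close> used only as a measurable space contributes its \<open>space\<close> and \<open>sets\<close>.
\<close>

abbreviation Omega :: "(nat \<Rightarrow> 'a measure) \<Rightarrow> nat \<Rightarrow> (nat \<Rightarrow> 'a) measure" where
  "Omega X n \<equiv> Pi\<^sub>M {..n} X"

text \<open>
  \<open>X\<^sub>0\<close> and \<open>\<Omega>\<^sub>n \<times> X\<^sub>n\<^sub>+\<^sub>1\<close> are identified with \<open>\<Omega>\<^sub>0\<close> and \<open>\<Omega>\<^sub>n\<^sub>+\<^sub>1\<close> by the canonical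
  bijections. The value of \<open>P\<close> at \<open>0\<close> is not used; the initial distribution is \<open>P0\<close>.
\<close>

primrec iter_kernel_prod :: "(nat \<Rightarrow> 'a measure) \<Rightarrow> 'a measure \<Rightarrow>
    (nat \<Rightarrow> (nat \<Rightarrow> 'a) \<Rightarrow> 'a measure) \<Rightarrow> nat \<Rightarrow> (nat \<Rightarrow> 'a) measure" where
  "iter_kernel_prod X P0 P 0 = distr P0 (Omega X 0) (\<lambda>x. \<lambda>i\<in>{..0}. x)"
| "iter_kernel_prod X P0 P (Suc n) =
     distr (kernel_prod (iter_kernel_prod X P0 P n) (X (Suc n)) (P (Suc n)))
       (Omega X (Suc n)) (\<lambda>(\<omega>, x). fun_upd \<omega> (Suc n) x)"

lemma measurable_prob_algebra_iff:
  "K \<in> M \<rightarrow>\<^sub>M prob_algebra N \<longleftrightarrow>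
     (\<forall>x\<in>space M. prob_space (K x) \<and> sets (K x) = sets N) \<and>
     (\<forall>A\<in>sets N. (\<lambda>x. emeasure (K x) A) \<in> borel_measurable M)"
proof
  assume K: "K \<in> M \<rightarrow>\<^sub>M prob_algebra N"
  show "(\<forall>x\<in>space M. prob_space (K x) \<and> sets (K x) = sets N) \<and>
     (\<forall>A\<in>sets N. (\<lambda>x. emeasure (K x) A) \<in> borel_measurable M)"
    using measurable_space[OF K] measurable_emeasure_kernel[OF measurable_prob_algebraD[OF K]]
    by (simp add: space_prob_algebra)
next
  assume "(\<forall>x\<in>space M. prob_space (K x) \<and> sets (K x) = sets N) \<and>
     (\<forall>A\<in>sets N. (\<lambda>x. emeasure (K x) A) \<in> borel_measurable M)"
  then show "K \<in> M \<rightarrow>\<^sub>M prob_algebra N"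
    by (intro measurable_prob_algebraI measurable_subprob_algebra)
       (auto intro: prob_space_imp_subprob_space)
qed

lemma tv_norm_eq:
  assumes S: "Hahn_set N (\<lambda>A. measure \<mu> A - measure \<mu>' A) S"
    and \<mu>: "finite_measure \<mu>" "sets N \<subseteq> sets \<mu>"
    and \<mu>': "finite_measure \<mu>'" "sets N \<subseteq> sets \<mu>'"
  shows "tv_norm N (\<lambda>A. measure \<mu> A - measure \<mu>' A) =
    (measure \<mu> S - measure \<mu>' S) - (measure \<mu> (space N - S) - measure \<mu>' (space N - S))"
proof -
  interpret \<mu>: finite_measure \<mu> by fact
  interpret \<mu>': finite_measure \<mu>' by fact
  define d where "d A = measure \<mu> A - measure \<mu>' A" for A
  have S': "Hahn_set N d S"
    using S by (simp add: d_def[abs_def])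
  have add: "d (A \<union> B) = d A + d B" if "A \<in> sets N" "B \<in> sets N" "A \<inter> B = {}" for A B
    using that \<mu>(2) \<mu>'(2) unfolding d_def
    by (subst \<mu>.finite_measure_Union, auto)+ (subst \<mu>'.finite_measure_Union, auto)
  have uniq: "d T - d (space N - T) = d S - d (space N - S)" if T: "Hahn_set N d T" for T
  proof -
    have [measurable]: "S \<in> sets N" "T \<in> sets N"
      using S' T by (auto simp: Hahn_set_def)
    have sp: "S \<subseteq> space N" "T \<subseteq> space N"
      by (simp_all add: sets.sets_into_space)
    have "S - T \<subseteq> S" "S - T \<subseteq> space N - T" "T - S \<subseteq> T" "T - S \<subseteq> space N - S"
      using sp by auto
    moreover have "S - T \<in> sets N" "T - S \<in> sets N"
      by simp_all
    ultimately have 0: "d (S - T) = 0" "d (T - S) = 0"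
      using S' T unfolding Hahn_set_def by (meson order.antisym)+
    have 1: "d S = d (S \<inter> T) + d (S - T)" "d T = d (T \<inter> S) + d (T - S)"
      using add[of "S \<inter> T" "S - T"] add[of "T \<inter> S" "T - S"]
      by (simp_all add: Int_Diff_Un Int_Diff_disjoint)
    have "S \<union> (space N - S) = space N" "T \<union> (space N - T) = space N"
      using sp by auto
    then have "d (space N) = d S + d (space N - S)" "d (space N) = d T + d (space N - T)"
      using add[of S "space N - S"] add[of T "space N - T"] by auto
    with 0 1 show ?thesis by (simp add: Int_commute[of T S])
  qed
  have "tv_norm N d = d S - d (space N - S)"
    unfolding tv_norm_def
  proof (rule the_equality)
    show "\<exists>T. Hahn_set N d T \<and> d S - d (space N - S) = d T + - d (space N - T)"
      using S' by auto
    fix v assume "\<exists>T. Hahn_set N d T \<and> v = d T + - d (space N - T)"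
    then obtain T where T: "Hahn_set N d T" and v: "v = d T + - d (space N - T)"
      by blast
    show "v = d S - d (space N - S)"
      unfolding uniq[OF T, symmetric] v by simp
  qed
  then show ?thesis by (simp add: d_def[abs_def])
qed

lemma Hahn_set_exists:
  assumes \<mu>: "finite_measure \<mu>" "space \<mu> = space N" "sets N \<subseteq> sets \<mu>"
    and \<mu>': "finite_measure \<mu>'" "space \<mu>' = space N" "sets N \<subseteq> sets \<mu>'"
  shows "\<exists>S. Hahn_set N (\<lambda>A. measure \<mu> A - measure \<mu>' A) S"
proof -
  interpret \<mu>: finite_measure \<mu> by fact
  interpret \<mu>': finite_measure \<mu>' by fact
  have sub: "subalgebra \<mu> N" "subalgebra \<mu>' N"
    using \<mu> \<mu>' by (auto simp: subalgebra_def)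
  have fin: "finite_measure (restr_to_subalg \<mu> N)" "finite_measure (restr_to_subalg \<mu>' N)"
    using sub \<mu>(1) \<mu>'(1) by (auto intro: finite_measure_restr_to_subalg)
  have "\<exists>S\<in>sets (restr_to_subalg \<mu> N).
      (\<forall>A\<in>sets (restr_to_subalg \<mu> N). A \<subseteq> S \<longrightarrow>
         emeasure (restr_to_subalg \<mu>' N) A \<le> emeasure (restr_to_subalg \<mu> N) A) \<and>
      (\<forall>A\<in>sets (restr_to_subalg \<mu> N). A \<inter> S = {} \<longrightarrow>
         emeasure (restr_to_subalg \<mu> N) A \<le> emeasure (restr_to_subalg \<mu>' N) A)"
    by (rule finite_unsigned_Hahn_decomposition[OF fin]) (simp add: sets_restr_to_subalg sub)
  then obtain S where S: "S \<in> sets N"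
      "\<And>A. A \<in> sets N \<Longrightarrow> A \<subseteq> S \<Longrightarrow> emeasure \<mu>' A \<le> emeasure \<mu> A"
      "\<And>A. A \<in> sets N \<Longrightarrow> A \<inter> S = {} \<Longrightarrow> emeasure \<mu> A \<le> emeasure \<mu>' A"
    by (auto simp: sets_restr_to_subalg emeasure_restr_to_subalg sub)
  show ?thesis
  proof (intro exI)
    show "Hahn_set N (\<lambda>A. measure \<mu> A - measure \<mu>' A) S"
      unfolding Hahn_set_def
    proof (intro conjI ballI impI)
      fix A assume "A \<in> sets N" "A \<subseteq> S"
      then show "0 \<le> measure \<mu> A - measure \<mu>' A"
        using S(2)[of A] by (simp add: \<mu>.emeasure_eq_measure \<mu>'.emeasure_eq_measure)
    next
      fix A assume A: "A \<in> sets N" "A \<subseteq> space N - S"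
      then have "A \<inter> S = {}" by auto
      with A show "measure \<mu> A - measure \<mu>' A \<le> 0"
        using S(3)[of A] by (simp add: \<mu>.emeasure_eq_measure \<mu>'.emeasure_eq_measure)
    qed (fact S(1))
  qed
qed

lemma tv_dist_eq_SUP:
  assumes \<mu>: "prob_space \<mu>" "space \<mu> = space N" "sets N \<subseteq> sets \<mu>"
    and \<mu>': "prob_space \<mu>'" "space \<mu>' = space N" "sets N \<subseteq> sets \<mu>'"
  shows "tv_dist N \<mu> \<mu>' = 2 * (SUP A\<in>sets N. \<bar>measure \<mu> A - measure \<mu>' A\<bar>)"
proof -
  interpret \<mu>: prob_space \<mu> by fact
  interpret \<mu>': prob_space \<mu>' by fact
  define d where "d A = measure \<mu> A - measure \<mu>' A" for A
  obtain S where H: "Hahn_set N d S"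
    using Hahn_set_exists[OF \<mu>.finite_measure_axioms \<mu>(2,3) \<mu>'.finite_measure_axioms \<mu>'(2,3)]
    by (auto simp: d_def[abs_def])
  then have [measurable]: "S \<in> sets N" by (simp add: Hahn_set_def)
  have add: "d (A \<union> B) = d A + d B" if "A \<in> sets N" "B \<in> sets N" "A \<inter> B = {}" for A B
    using that \<mu>(3) \<mu>'(3) unfolding d_def
    by (subst \<mu>.finite_measure_Union, auto)+ (subst \<mu>'.finite_measure_Union, auto)
  have sp: "d (space N) = 0"
    using \<mu>.prob_space \<mu>'.prob_space \<mu>(2) \<mu>'(2) by (simp add: d_def)
  have compl: "d (space N - A) = - d A" if "A \<in> sets N" for A
    using add[of A "space N - A"] sp that sets.sets_into_space[OF that] by (auto simp: Un_absorb1)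
  have tv: "tv_dist N \<mu> \<mu>' = 2 * d S"
    using tv_norm_eq[OF H[unfolded d_def[abs_def]] \<mu>.finite_measure_axioms \<mu>(3)
      \<mu>'.finite_measure_axioms \<mu>'(3)] compl[of S]
    by (simp add: tv_dist_def d_def)
  have le: "d A \<le> d S" if [measurable]: "A \<in> sets N" for A
  proof -
    have "d A = d (A \<inter> S) + d (A - S)" "d S = d (S \<inter> A) + d (S - A)"
      using add[of "A \<inter> S" "A - S"] add[of "S \<inter> A" "S - A"]
      by (simp_all add: Int_Diff_Un Int_Diff_disjoint)
    moreover have "A - S \<subseteq> space N - S" "S - A \<subseteq> S"
      using sets.sets_into_space[OF that] by auto
    then have "d (A - S) \<le> 0" "0 \<le> d (S - A)"
      using H unfolding Hahn_set_def by simp_all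
    ultimately show ?thesis by (simp add: Int_commute[of S A])
  qed
  have abs: "\<bar>d A\<bar> \<le> d S" if "A \<in> sets N" for A
    using le[of A] le[of "space N - A"] compl[of A] that by auto
  have "(SUP A\<in>sets N. \<bar>d A\<bar>) = d S"
  proof (rule cSup_eq_maximum)
    show "d S \<in> (\<lambda>A. \<bar>d A\<bar>) ` sets N"
      using abs[of S] by (intro image_eqI[of _ _ S]) auto
  qed (use abs in auto)
  with tv show ?thesis by (simp add: d_def)
qed

lemma kernel_prod:
  assumes \<mu>: "prob_space \<mu>" and K: "K \<in> \<mu> \<rightarrow>\<^sub>M prob_algebra N"
  shows prob_space_kernel_prod: "prob_space (kernel_prod \<mu> N K)"
    and sets_kernel_prod: "sets (kernel_prod \<mu> N K) = sets (\<mu> \<Otimes>\<^sub>M N)"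
    and emeasure_kernel_prod_Times: "\<And>A B. A \<in> sets \<mu> \<Longrightarrow> B \<in> sets N \<Longrightarrow>
      emeasure (kernel_prod \<mu> N K) (A \<times> B) = (\<integral>\<^sup>+x\<in>A. emeasure (K x) B \<partial>\<mu>)"
proof -
  define Q where "Q R \<longleftrightarrow> prob_space R \<and> sets R = sets (\<mu> \<Otimes>\<^sub>M N) \<and>
     (\<forall>A\<in>sets \<mu>. \<forall>B\<in>sets N. emeasure R (A \<times> B) = (\<integral>\<^sup>+x\<in>A. emeasure (K x) B \<partial>\<mu>))" for R
  have \<mu>_in: "\<mu> \<in> space (prob_algebra \<mu>)"
    using \<mu> by (simp add: space_prob_algebra)
  define L where "L x = distr (K x) (\<mu> \<Otimes>\<^sub>M N) (Pair x)" for x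
  have L: "L \<in> \<mu> \<rightarrow>\<^sub>M prob_algebra (\<mu> \<Otimes>\<^sub>M N)"
    unfolding L_def[abs_def] by (rule measurable_distr_prob_space2[OF K]) simp
  have ex: "Q (\<mu> \<bind> L)"
    unfolding Q_def
  proof (intro conjI ballI)
    show "prob_space (\<mu> \<bind> L)" "sets (\<mu> \<bind> L) = sets (\<mu> \<Otimes>\<^sub>M N)"
      using prob_space_bind'[OF \<mu>_in L] sets_bind'[OF \<mu>_in L] by auto
    fix A B assume AB[measurable]: "A \<in> sets \<mu>" "B \<in> sets N"
    have "emeasure (L x) (A \<times> B) = emeasure (K x) B * indicator A x" if x: "x \<in> space \<mu>" for x
    proof -
      have [measurable_cong]: "sets (K x) = sets N"
        using measurable_space[OF K x] by (simp add: space_prob_algebra)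
      have "Pair x -` (A \<times> B) \<inter> space (K x) = (if x \<in> A then B else {})"
        using sets.sets_into_space[OF AB(2)] sets_eq_imp_space_eq[OF \<open>sets (K x) = sets N\<close>] by auto
      then show ?thesis
        using x unfolding L_def by (subst emeasure_distr) (auto simp: measurable_Pair1')
    qed
    then show "emeasure (\<mu> \<bind> L) (A \<times> B) = (\<integral>\<^sup>+x\<in>A. emeasure (K x) B \<partial>\<mu>)"
      by (subst emeasure_bind_prob_algebra[OF \<mu>_in L]) (auto intro!: nn_integral_cong)
  qed
  have uniq: "R = R'" if R: "Q R" and R': "Q R'" for R R'
  proof (rule measure_eqI_generator_eq[OF Int_stable_pair_measure_generator[of \<mu> N]
      pair_measure_closed[of \<mu> N], where A = "\<lambda>_. space \<mu> \<times> space N"])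
    show "sets R = sigma_sets (space \<mu> \<times> space N) {a \<times> b |a b. a \<in> sets \<mu> \<and> b \<in> sets N}"
      "sets R' = sigma_sets (space \<mu> \<times> space N) {a \<times> b |a b. a \<in> sets \<mu> \<and> b \<in> sets N}"
      using R R' by (auto simp: Q_def sets_pair_measure)
    show "emeasure R (space \<mu> \<times> space N) \<noteq> \<infinity>"
      unfolding infinity_ennreal_def
      by (rule finite_measure.emeasure_finite[OF prob_space.finite_measure])
        (use R in \<open>simp add: Q_def\<close>)
  qed (use R R' in \<open>auto simp: Q_def\<close>)
  have "Q (THE R. Q R)"
    by (rule theI[of Q, OF ex uniq[OF _ ex]])
  then have "Q (kernel_prod \<mu> N K)"
    by (simp add: kernel_prod_def Q_def)
  then show "prob_space (kernel_prod \<mu> N K)"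
    "sets (kernel_prod \<mu> N K) = sets (\<mu> \<Otimes>\<^sub>M N)"
    "\<And>A B. A \<in> sets \<mu> \<Longrightarrow> B \<in> sets N \<Longrightarrow>
      emeasure (kernel_prod \<mu> N K) (A \<times> B) = (\<integral>\<^sup>+x\<in>A. emeasure (K x) B \<partial>\<mu>)"
    by (auto simp: Q_def)
qed

lemma iter_kernel_prod_in_prob_algebra:
  assumes "P0 \<in> space (prob_algebra (X 0))"
    and "\<And>k. 1 \<le> k \<Longrightarrow> P k \<in> Omega X (k - 1) \<rightarrow>\<^sub>M prob_algebra (X k)"
  shows "iter_kernel_prod X P0 P n \<in> space (prob_algebra (Omega X n))"
proof (induction n)
  case 0
  have [measurable_cong]: "sets P0 = sets (X 0)" and "prob_space P0"
    using assms(1) by (auto simp: space_prob_algebra)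
  then show ?case
    by (auto simp: space_prob_algebra intro!: prob_space.prob_space_distr measurable_restrict)
next
  case (Suc n)
  let ?\<mu> = "iter_kernel_prod X P0 P n" and ?f = "\<lambda>(\<omega>, x). fun_upd \<omega> (Suc n) x"
  have s: "sets ?\<mu> = sets (Omega X n)" and p: "prob_space ?\<mu>"
    using Suc by (auto simp: space_prob_algebra)
  have K: "P (Suc n) \<in> ?\<mu> \<rightarrow>\<^sub>M prob_algebra (X (Suc n))"
    using assms(2)[of "Suc n"] by (simp add: measurable_cong_sets[OF s refl])
  have *: "sets (kernel_prod ?\<mu> (X (Suc n)) (P (Suc n))) = sets (Omega X n \<Otimes>\<^sub>M X (Suc n))"
    using sets_kernel_prod[OF p K] sets_pair_measure_cong[OF s refl] by simp
  have "?f \<in> kernel_prod ?\<mu> (X (Suc n)) (P (Suc n)) \<rightarrow>\<^sub>M Omega X (Suc n)"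
    unfolding measurable_cong_sets[OF * refl] atMost_Suc by (rule measurable_add_dim)
  then show ?case
    using prob_space_kernel_prod[OF p K]
    by (auto simp: space_prob_algebra intro!: prob_space.prob_space_distr)
qed

end

theory Submission
  imports Defs
begin

text \<open>
  For \<open>A\<close> in the smaller \<open>\<sigma>\<close>-algebra on \<open>\<Omega>\<^sub>n\<^sub>+\<^sub>1\<close>, with sections \<open>A\<^sub>\<omega>\<close>, the difference of the two
  products at \<open>A\<close> is \<open>\<integral> (P\<^sub>\<omega>(A\<^sub>\<omega>) - Q\<^sub>\<omega>(A\<^sub>\<omega>)) dP\<^sup>n + \<integral> Q\<^sub>\<omega>(A\<^sub>\<omega>) d(P\<^sup>n - Q\<^sup>n)\<close>.
  The first integrand is at most \<open>c\<^sub>n\<^sub>+\<^sub>1 / 2\<close>. In the second integral \<open>\<omega> \<mapsto> Q\<^sub>\<omega>(A\<^sub>\<omega>)\<close> takes values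
  in \<open>[0,1]\<close> and is measurable for the smaller \<open>\<sigma>\<close>-algebra, so integrating over its superlevel sets
  bounds the integral by half the distance of \<open>P\<^sup>n\<close> and \<open>Q\<^sup>n\<close>.
\<close>

section \<open>Total variation bounds for two probability measures\<close>

lemma tv_dist_le_iff:
  assumes "prob_space \<mu>" "space \<mu> = space N" "sets N \<subseteq> sets \<mu>"
    and "prob_space \<mu>'" "space \<mu>' = space N" "sets N \<subseteq> sets \<mu>'"
  shows "tv_dist N \<mu> \<mu>' \<le> v \<longleftrightarrow> (\<forall>A\<in>sets N. \<bar>measure \<mu> A - measure \<mu>' A\<bar> \<le> v / 2)"
proof -
  interpret \<mu>: prob_space \<mu> by fact
  interpret \<mu>': prob_space \<mu>' by fact
  have "bdd_above ((\<lambda>A. \<bar>measure \<mu> A - measure \<mu>' A\<bar>) ` sets N)"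
  proof (rule bdd_aboveI2)
    fix A show "\<bar>measure \<mu> A - measure \<mu>' A\<bar> \<le> 1"
      using \<mu>.prob_le_1[of A] \<mu>'.prob_le_1[of A] measure_nonneg[of \<mu> A] measure_nonneg[of \<mu>' A]
      by linarith
  qed
  then have "(SUP A\<in>sets N. \<bar>measure \<mu> A - measure \<mu>' A\<bar>) \<le> v / 2 \<longleftrightarrow>
      (\<forall>A\<in>sets N. \<bar>measure \<mu> A - measure \<mu>' A\<bar> \<le> v / 2)"
    by (intro cSUP_le_iff) auto
  then show ?thesis
    unfolding tv_dist_eq_SUP[OF assms] by auto
qed

text \<open>A one-sided estimate is enough: both measures have total mass \<open>1\<close>, so the
  estimate at \<open>space N - A\<close> is the reverse estimate at \<open>A\<close>.\<close>

lemma tv_dist_leI: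
  assumes \<mu>: "prob_space \<mu>" "space \<mu> = space N" "sets N \<subseteq> sets \<mu>"
    and \<mu>': "prob_space \<mu>'" "space \<mu>' = space N" "sets N \<subseteq> sets \<mu>'"
    and le: "\<And>A. A \<in> sets N \<Longrightarrow> measure \<mu> A \<le> measure \<mu>' A + v / 2"
  shows "tv_dist N \<mu> \<mu>' \<le> v"
  unfolding tv_dist_le_iff[OF \<mu> \<mu>']
proof
  interpret \<mu>: prob_space \<mu> by fact
  interpret \<mu>': prob_space \<mu>' by fact
  fix A assume A: "A \<in> sets N"
  then have "measure \<mu> (space N - A) = 1 - measure \<mu> A" "measure \<mu>' (space N - A) = 1 - measure \<mu>' A"
    using \<mu>.prob_compl[of A] \<mu>'.prob_compl[of A] \<mu> \<mu>' by auto
  then show "\<bar>measure \<mu> A - measure \<mu>' A\<bar> \<le> v / 2"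
    using le[of A] le[OF sets.compl_sets[OF A]] A by linarith
qed

text \<open>This form can be integrated with \<open>nn_integral\<close>. Nothing is lost because
  \<open>ennreal\<close> truncates negative reals to \<open>0\<close>: the bound on an absolute
  value forces \<open>0 \<le> v / 2\<close>.\<close>

lemma emeasure_le_add_tv_dist:
  assumes \<mu>: "prob_space \<mu>" "space \<mu> = space N" "sets N \<subseteq> sets \<mu>"
    and \<mu>': "prob_space \<mu>'" "space \<mu>' = space N" "sets N \<subseteq> sets \<mu>'"
    and v: "tv_dist N \<mu> \<mu>' \<le> v" and A: "A \<in> sets N"
  shows "emeasure \<mu> A \<le> emeasure \<mu>' A + ennreal (v / 2)"
proof -
  interpret \<mu>: prob_space \<mu> by fact
  interpret \<mu>': prob_space \<mu>' by fact
  have "\<bar>measure \<mu> A - measure \<mu>' A\<bar> \<le> v / 2"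
    using v A tv_dist_le_iff[OF \<mu> \<mu>'] by blast
  then have "measure \<mu> A \<le> measure \<mu>' A + v / 2" "0 \<le> v / 2"
    by linarith+
  then show ?thesis
    by (simp add: \<mu>.emeasure_eq_measure \<mu>'.emeasure_eq_measure flip: ennreal_plus)
qed

lemma tv_dist_nonneg:
  assumes "prob_space \<mu>" "space \<mu> = space N" "sets N \<subseteq> sets \<mu>"
    and "prob_space \<mu>'" "space \<mu>' = space N" "sets N \<subseteq> sets \<mu>'"
  shows "0 \<le> tv_dist N \<mu> \<mu>'"
  using tv_dist_le_iff[OF assms, of "tv_dist N \<mu> \<mu>'"]
  \<comment> \<open>At the empty set the left side of the bound is \<open>0\<close>.\<close>
  by (auto dest!: bspec[OF _ sets.empty_sets])

lemma tv_dist_le_2: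
  assumes \<mu>: "prob_space \<mu>" "space \<mu> = space N" "sets N \<subseteq> sets \<mu>"
    and \<mu>': "prob_space \<mu>'" "space \<mu>' = space N" "sets N \<subseteq> sets \<mu>'"
  shows "tv_dist N \<mu> \<mu>' \<le> 2"
proof (rule tv_dist_leI[OF assms])
  fix A show "measure \<mu> A \<le> measure \<mu>' A + 2 / 2"
    using prob_space.prob_le_1[OF \<mu>(1), of A] measure_nonneg[of \<mu>' A] by linarith
qed

text \<open>A real-valued \<open>SUP\<close> dominates its members only if they are bounded above;
  the uniform bound \<open>2\<close> provides this.\<close>

lemma tv_dist_le_kernel_tv_dist:
  assumes \<omega>: "\<omega> \<in> space M" and sub: "subalgebra N N'"
    and K: "\<And>x. x \<in> space M \<Longrightarrow> K x \<in> space (prob_algebra N)"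
    and K': "\<And>x. x \<in> space M \<Longrightarrow> K' x \<in> space (prob_algebra N')"
  shows "tv_dist N' (K \<omega>) (K' \<omega>) \<le> kernel_tv_dist M N' K K'"
  unfolding kernel_tv_dist_def
proof (rule cSUP_upper[OF \<omega> bdd_aboveI2])
  fix x assume x: "x \<in> space M"
  show "tv_dist N' (K x) (K' x) \<le> 2"
    using K[OF x] K'[OF x] sub
    by (intro tv_dist_le_2) (auto simp: space_prob_algebra subalgebra_def dest: sets_eq_imp_space_eq)
qed

section \<open>Integrals of functions with values in the unit interval\<close>

text \<open>The value \<open>g x\<close> is the length of the set of \<open>t\<close> in
  \<open>{0..1}\<close> with \<open>t \<le> g x\<close>. Writing it as an integral over
  \<open>t\<close> and exchanging the integrals leaves the measures of the superlevel sets.\<close>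

lemma nn_integral_layer_cake:
  assumes "sigma_finite_measure \<mu>" and [measurable]: "g \<in> borel_measurable \<mu>"
    and g: "\<And>x. x \<in> space \<mu> \<Longrightarrow> 0 \<le> g x \<and> g x \<le> (1::real)"
  shows "(\<integral>\<^sup>+x. ennreal (g x) \<partial>\<mu>) =
    (\<integral>\<^sup>+t. emeasure \<mu> {x\<in>space \<mu>. t \<le> g x} * indicator {0..1} t \<partial>lborel)"
proof -
  interpret \<mu>: sigma_finite_measure \<mu> by fact
  interpret pair_sigma_finite \<mu> lborel ..
  let ?f = "\<lambda>x t. indicator {x\<in>space \<mu>. t \<le> g x} x * indicator {0..1} t :: ennreal"
  have "(\<integral>\<^sup>+x. ennreal (g x) \<partial>\<mu>) = (\<integral>\<^sup>+x. \<integral>\<^sup>+t. ?f x t \<partial>lborel \<partial>\<mu>)"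
  proof (rule nn_integral_cong)
    fix x assume x: "x \<in> space \<mu>"
    \<comment> \<open>Since \<open>g x \<le> 1\<close>, the two constraints on \<open>t\<close>
      together describe exactly \<open>{0..g x}\<close>.\<close>
    have "(\<integral>\<^sup>+t. ?f x t \<partial>lborel) = (\<integral>\<^sup>+t. indicator {0..g x} t \<partial>lborel)"
      using x g[OF x] by (intro nn_integral_cong) (auto simp: indicator_def)
    then show "ennreal (g x) = (\<integral>\<^sup>+t. ?f x t \<partial>lborel)"
      using g[OF x] by simp
  qed
  also have "\<dots> = (\<integral>\<^sup>+t. \<integral>\<^sup>+x. ?f x t \<partial>\<mu> \<partial>lborel)"
    by (rule Fubini'[symmetric]) measurable
  also have "\<dots> = (\<integral>\<^sup>+t. emeasure \<mu> {x\<in>space \<mu>. t \<le> g x} * indicator {0..1} t \<partial>lborel)"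
    by (intro nn_integral_cong) (simp add: nn_integral_multc)
  finally show ?thesis .
qed

text \<open>Carries a uniform estimate on sets of \<open>N\<close> over to integrals with the same
  constant. No factor appears because the levels \<open>t\<close> range over an interval of length
  \<open>1\<close>.\<close>

lemma nn_integral_le_add_const:
  assumes \<mu>: "prob_space \<mu>" "space \<mu> = space N" "sets N \<subseteq> sets \<mu>"
    and \<mu>': "prob_space \<mu>'" "space \<mu>' = space N" "sets N \<subseteq> sets \<mu>'"
    and le: "\<And>A. A \<in> sets N \<Longrightarrow> emeasure \<mu> A \<le> emeasure \<mu>' A + d"
    and g[measurable]: "g \<in> borel_measurable N"
    and g01: "\<And>x. x \<in> space N \<Longrightarrow> 0 \<le> g x \<and> g x \<le> (1::real)"
  shows "(\<integral>\<^sup>+x. ennreal (g x) \<partial>\<mu>) \<le> (\<integral>\<^sup>+x. ennreal (g x) \<partial>\<mu>') + d"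
proof -
  interpret \<mu>: prob_space \<mu> by fact
  interpret \<mu>': prob_space \<mu>' by fact
  have [measurable]: "g \<in> borel_measurable \<mu>" "g \<in> borel_measurable \<mu>'"
    using measurable_from_subalg[OF _ g] \<mu> \<mu>' by (auto simp: subalgebra_def)
  have [measurable]: "(\<lambda>t. emeasure \<mu>' {x\<in>space \<mu>'. t \<le> g x}) \<in> borel_measurable lborel"
    by measurable
  have "(\<integral>\<^sup>+x. ennreal (g x) \<partial>\<mu>) =
      (\<integral>\<^sup>+t. emeasure \<mu> {x\<in>space N. t \<le> g x} * indicator {0..1} t \<partial>lborel)"
    using nn_integral_layer_cake[OF \<mu>.sigma_finite_measure_axioms, of g] g01 \<mu>(2) by simp
  \<comment> \<open>As \<open>g\<close> is measurable for \<open>N\<close> itself, every superlevel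
    set lies in the smaller \<sigma>-algebra, where \<open>le\<close> applies.\<close>
  also have "\<dots> \<le> (\<integral>\<^sup>+t. (emeasure \<mu>' {x\<in>space N. t \<le> g x} + d) * indicator {0..1} t \<partial>lborel)"
    by (intro nn_integral_mono mult_right_mono le) auto
  also have "\<dots> = (\<integral>\<^sup>+t. emeasure \<mu>' {x\<in>space \<mu>'. t \<le> g x} * indicator {0..1} t
      + d * indicator {0..1} (t::real) \<partial>lborel)"
    by (simp add: \<mu>' distrib_right)
  also have "\<dots> = (\<integral>\<^sup>+t. emeasure \<mu>' {x\<in>space \<mu>'. t \<le> g x} * indicator {0..1} t \<partial>lborel) + d"
    by (subst nn_integral_add) (auto simp: nn_integral_cmult)
  also have "\<dots> = (\<integral>\<^sup>+x. ennreal (g x) \<partial>\<mu>') + d"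
    using nn_integral_layer_cake[OF \<mu>'.sigma_finite_measure_axioms, of g] g01 \<mu>'(2) by simp
  finally show ?thesis .
qed

section \<open>Kernel products evaluated through sections\<close>

lemma kernel_section_measurable:
  assumes K: "K \<in> \<mu> \<rightarrow>\<^sub>M prob_algebra N" and A: "A \<in> sets (\<mu> \<Otimes>\<^sub>M N)"
  shows "(\<lambda>x. emeasure (K x) (Pair x -` A)) \<in> borel_measurable \<mu>"
proof (rule emeasure_measurable_subprob_algebra2[OF _ measurable_prob_algebraD[OF K]])
  have "(SIGMA x:space \<mu>. Pair x -` A) = A"
    using sets.sets_into_space[OF A] by (auto simp: space_pair_measure)
  with A show "(SIGMA x:space \<mu>. Pair x -` A) \<in> sets (\<mu> \<Otimes>\<^sub>M N)"
    by simp
qed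

text \<open>The definition prescribes values on rectangles only. The measure
  \<open>\<mu> \<bind> L\<close> satisfies the section formula on all measurable sets and agrees
  with the kernel product on rectangles, an intersection-stable generator, so the two measures
  coincide.\<close>

lemma emeasure_kernel_prod:
  assumes \<mu>: "prob_space \<mu>" and K: "K \<in> \<mu> \<rightarrow>\<^sub>M prob_algebra N" and A: "A \<in> sets (\<mu> \<Otimes>\<^sub>M N)"
  shows "emeasure (kernel_prod \<mu> N K) A = (\<integral>\<^sup>+x. emeasure (K x) (Pair x -` A) \<partial>\<mu>)"
proof -
  have \<mu>_in: "\<mu> \<in> space (prob_algebra \<mu>)"
    using \<mu> by (simp add: space_prob_algebra)
  define L where "L x = distr (K x) (\<mu> \<Otimes>\<^sub>M N) (Pair x)" for x
  have L: "L \<in> \<mu> \<rightarrow>\<^sub>M prob_algebra (\<mu> \<Otimes>\<^sub>M N)"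
    unfolding L_def[abs_def] by (rule measurable_distr_prob_space2[OF K]) simp
  have bind: "emeasure (\<mu> \<bind> L) B = (\<integral>\<^sup>+x. emeasure (K x) (Pair x -` B) \<partial>\<mu>)"
    if B: "B \<in> sets (\<mu> \<Otimes>\<^sub>M N)" for B
  proof -
    have "emeasure (L x) B = emeasure (K x) (Pair x -` B)" if x: "x \<in> space \<mu>" for x
    proof -
      have s: "sets (K x) = sets N"
        using measurable_space[OF K x] by (simp add: space_prob_algebra)
      have "Pair x -` B \<subseteq> space (K x)"
        using sets.sets_into_space[OF B] sets_eq_imp_space_eq[OF s] by (auto simp: space_pair_measure)
      moreover have "Pair x \<in> K x \<rightarrow>\<^sub>M \<mu> \<Otimes>\<^sub>M N"
        using x by (simp add: measurable_cong_sets[OF s refl])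
      ultimately show ?thesis
        using B unfolding L_def by (subst emeasure_distr) (auto simp: Int_absorb2)
    qed
    then show ?thesis
      by (subst emeasure_bind_prob_algebra[OF \<mu>_in L B]) (auto intro!: nn_integral_cong)
  qed
  have "kernel_prod \<mu> N K = \<mu> \<bind> L"
  proof (rule measure_eqI_generator_eq[OF Int_stable_pair_measure_generator[of \<mu> N]
      pair_measure_closed[of \<mu> N], where A = "\<lambda>_. space \<mu> \<times> space N"])
    show "sets (kernel_prod \<mu> N K) = sigma_sets (space \<mu> \<times> space N) {a \<times> b |a b. a \<in> sets \<mu> \<and> b \<in> sets N}"
      "sets (\<mu> \<bind> L) = sigma_sets (space \<mu> \<times> space N) {a \<times> b |a b. a \<in> sets \<mu> \<and> b \<in> sets N}"
      using sets_kernel_prod[OF \<mu> K] sets_bind'[OF \<mu>_in L] by (auto simp: sets_pair_measure)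
    show "emeasure (kernel_prod \<mu> N K) (space \<mu> \<times> space N) \<noteq> \<infinity>"
      using prob_space.finite_measure[OF prob_space_kernel_prod[OF \<mu> K]]
      by (simp add: finite_measure.emeasure_finite)
    fix B assume "B \<in> {a \<times> b |a b. a \<in> sets \<mu> \<and> b \<in> sets N}"
    then obtain a b where B: "B = a \<times> b" "a \<in> sets \<mu>" "b \<in> sets N"
      by blast
    show "emeasure (kernel_prod \<mu> N K) B = emeasure (\<mu> \<bind> L) B"
      using B by (subst bind)
        (auto simp: emeasure_kernel_prod_Times[OF \<mu> K] indicator_def intro!: nn_integral_cong)
  qed auto
  with bind[OF A] show ?thesis
    by simp
qed

section \<open>Finite products and one step of the iteration\<close>

text \<open>The inclusion of \<sigma>-algebras amounts to measurability of the identity map, which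
  can be checked coordinatewise.\<close>

lemma subalgebra_PiM:
  assumes "\<And>i. i \<in> I \<Longrightarrow> subalgebra (X i) (Y i)"
  shows "subalgebra (Pi\<^sub>M I X) (Pi\<^sub>M I Y)"
proof -
  have sp: "space (Pi\<^sub>M I X) = space (Pi\<^sub>M I Y)"
    using assms by (auto simp: space_PiM subalgebra_def intro!: PiE_cong)
  have "(\<lambda>x. x) \<in> Pi\<^sub>M I X \<rightarrow>\<^sub>M Pi\<^sub>M I Y"
  proof (rule measurable_PiM_single')
    fix i assume i: "i \<in> I"
    show "(\<lambda>\<omega>. \<omega> i) \<in> Pi\<^sub>M I X \<rightarrow>\<^sub>M Y i"
      using measurable_comp[OF measurable_component_singleton[OF i, of X]
          measurable_from_subalg[OF assms[OF i] measurable_ident]]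
      by (simp add: comp_def)
  next
    show "(\<lambda>x. x) \<in> space (Pi\<^sub>M I X) \<rightarrow> (\<Pi>\<^sub>E i\<in>I. space (Y i))"
      using sp by (simp add: space_PiM[of I Y])
  qed
  from measurable_sets[OF this] have "A \<in> sets (Pi\<^sub>M I X)" if "A \<in> sets (Pi\<^sub>M I Y)" for A
    using that sets.sets_into_space[OF that] sp by (metis Int_absorb2 vimage_ident)
  with sp show ?thesis
    by (auto simp: subalgebra_def)
qed

text \<open>The section formula is pulled through the identification of pairs with functions on
  \<open>{..Suc n}\<close>; \<open>A'\<close> is \<open>A\<close> seen as a set of pairs.\<close>

lemma emeasure_iter_kernel_prod_Suc:
  assumes P0: "P0 \<in> space (prob_algebra (X 0))"
    and P: "\<And>k. 1 \<le> k \<Longrightarrow> P k \<in> Omega X (k - 1) \<rightarrow>\<^sub>M prob_algebra (X k)"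
    and A: "A \<in> sets (Omega X (Suc n))"
  defines "A' \<equiv> (\<lambda>(\<omega>, x). fun_upd \<omega> (Suc n) x) -` A \<inter> space (Omega X n \<Otimes>\<^sub>M X (Suc n))"
  shows "emeasure (iter_kernel_prod X P0 P (Suc n)) A =
    (\<integral>\<^sup>+\<omega>. emeasure (P (Suc n) \<omega>) (Pair \<omega> -` A') \<partial>iter_kernel_prod X P0 P n)"
proof -
  let ?\<mu> = "iter_kernel_prod X P0 P n" and ?f = "\<lambda>(\<omega>, x). fun_upd \<omega> (Suc n) x"
  have s: "sets ?\<mu> = sets (Omega X n)" and p: "prob_space ?\<mu>"
    using iter_kernel_prod_in_prob_algebra[of P0 X P n, OF P0 P] by (auto simp: space_prob_algebra)
  have K: "P (Suc n) \<in> ?\<mu> \<rightarrow>\<^sub>M prob_algebra (X (Suc n))"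
    using P[of "Suc n"] by (simp add: measurable_cong_sets[OF s refl])
  have s2: "sets (?\<mu> \<Otimes>\<^sub>M X (Suc n)) = sets (Omega X n \<Otimes>\<^sub>M X (Suc n))"
    by (rule sets_pair_measure_cong[OF s refl])
  have s1: "sets (kernel_prod ?\<mu> (X (Suc n)) (P (Suc n))) = sets (Omega X n \<Otimes>\<^sub>M X (Suc n))"
    using sets_kernel_prod[OF p K] s2 by simp
  have f: "?f \<in> Omega X n \<Otimes>\<^sub>M X (Suc n) \<rightarrow>\<^sub>M Omega X (Suc n)"
    unfolding atMost_Suc by (rule measurable_add_dim)
  then have f': "?f \<in> kernel_prod ?\<mu> (X (Suc n)) (P (Suc n)) \<rightarrow>\<^sub>M Omega X (Suc n)"
    by (simp only: measurable_cong_sets[OF s1 refl])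
  have "A' \<in> sets (?\<mu> \<Otimes>\<^sub>M X (Suc n))"
    using measurable_sets[OF f A] s2 by (simp add: A'_def)
  then have "emeasure (kernel_prod ?\<mu> (X (Suc n)) (P (Suc n))) A' =
      (\<integral>\<^sup>+\<omega>. emeasure (P (Suc n) \<omega>) (Pair \<omega> -` A') \<partial>?\<mu>)"
    by (rule emeasure_kernel_prod[OF p K])
  then show ?thesis
    using emeasure_distr[OF f' A] sets_eq_imp_space_eq[OF s1] by (simp add: A'_def)
qed

section \<open>Induction along the iterated product\<close>

theorem theorem1:
  fixes X Y :: "nat \<Rightarrow> 'a measure"
    and P0 Q0 :: "'a measure"
    and P Q :: "nat \<Rightarrow> (nat \<Rightarrow> 'a) \<Rightarrow> 'a measure"
    and c :: "nat \<Rightarrow> real"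
    and n :: nat
  assumes "\<And>k. subalgebra (X k) (Y k)"
    and "P0 \<in> space (prob_algebra (X 0))"
    and "Q0 \<in> space (prob_algebra (Y 0))"
    and "\<And>k. 1 \<le> k \<Longrightarrow> P k \<in> Omega X (k - 1) \<rightarrow>\<^sub>M prob_algebra (X k)"
    and "\<And>k. 1 \<le> k \<Longrightarrow> Q k \<in> Omega Y (k - 1) \<rightarrow>\<^sub>M prob_algebra (Y k)"
    and "tv_dist (Y 0) P0 Q0 \<le> c 0"
    and "\<And>k. 1 \<le> k \<Longrightarrow> kernel_tv_dist (Omega X (k - 1)) (Y k) (P k) (Q k) \<le> c k"
  shows "tv_dist (Omega Y n) (iter_kernel_prod X P0 P n) (iter_kernel_prod Y Q0 Q n)
           \<le> (\<Sum>k=0..n. c k)"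
proof (induction n)
  note sub = assms(1) and P0 = assms(2) and Q0 = assms(3) and P = assms(4) and Q = assms(5)
    and c0 = assms(6) and c = assms(7)
  note iterP = iter_kernel_prod_in_prob_algebra[of P0 X P, OF P0 P]
  note iterQ = iter_kernel_prod_in_prob_algebra[of Q0 Y Q, OF Q0 Q]
  have subO: "subalgebra (Omega X m) (Omega Y m)" for m
    by (rule subalgebra_PiM) (rule sub)
  have IP: "prob_space (iter_kernel_prod X P0 P m)"
    "space (iter_kernel_prod X P0 P m) = space (Omega Y m)"
    "sets (Omega Y m) \<subseteq> sets (iter_kernel_prod X P0 P m)" for m
    using iterP[of m] subO[of m]
    by (auto simp: space_prob_algebra subalgebra_def dest: sets_eq_imp_space_eq)
  have IQ: "prob_space (iter_kernel_prod Y Q0 Q m)"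
    "space (iter_kernel_prod Y Q0 Q m) = space (Omega Y m)"
    "sets (Omega Y m) \<subseteq> sets (iter_kernel_prod Y Q0 Q m)" for m
    using iterQ[of m]
    by (auto simp: space_prob_algebra dest: sets_eq_imp_space_eq)
  {
    case 0
    have sP: "sets P0 = sets (X 0)" and pP: "prob_space P0"
      and sQ: "sets Q0 = sets (Y 0)" and pQ: "prob_space Q0"
      using P0 Q0 by (auto simp: space_prob_algebra)
    have PY: "space P0 = space (Y 0)" "sets (Y 0) \<subseteq> sets P0" "space Q0 = space (Y 0)"
      "sets (Y 0) \<subseteq> sets Q0"
      using sub[of 0] sP sQ by (auto simp: subalgebra_def dest: sets_eq_imp_space_eq)
    let ?h = "\<lambda>x. \<lambda>i\<in>{..0::nat}. x"
    \<comment> \<open>The first two facts evaluate the image measures; \<open>hY\<close> places the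
      preimage of \<open>A\<close> in the smaller \<sigma>-algebra, where \<open>c 0\<close>
      controls the difference.\<close>
    have hX: "?h \<in> P0 \<rightarrow>\<^sub>M Omega X 0" and hQ: "?h \<in> Q0 \<rightarrow>\<^sub>M Omega Y 0"
      and hY: "?h \<in> Y 0 \<rightarrow>\<^sub>M Omega Y 0"
      using sP sQ by (auto intro!: measurable_restrict measurable_ident_sets)
    show ?case
    proof (rule tv_dist_leI[OF IP IQ])
      fix A assume A: "A \<in> sets (Omega Y 0)"
      then have AX: "A \<in> sets (Omega X 0)"
        using subO[of 0] by (auto simp: subalgebra_def)
      have "\<bar>measure P0 (?h -` A \<inter> space (Y 0)) - measure Q0 (?h -` A \<inter> space (Y 0))\<bar> \<le> c 0 / 2"
        using c0 measurable_sets[OF hY A] tv_dist_le_iff[OF pP PY(1,2) pQ PY(3,4)] by blast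
      then have "measure P0 (?h -` A \<inter> space (Y 0)) \<le> measure Q0 (?h -` A \<inter> space (Y 0)) + c 0 / 2"
        by linarith
      then show "measure (iter_kernel_prod X P0 P 0) A
          \<le> measure (iter_kernel_prod Y Q0 Q 0) A + (\<Sum>k = 0..0. c k) / 2"
        using measure_distr[OF hX AX] measure_distr[OF hQ A] PY(1,3) by simp
    qed
  next
    case (Suc n)
    let ?\<mu> = "iter_kernel_prod X P0 P n" and ?\<nu> = "iter_kernel_prod Y Q0 Q n"
    let ?f = "\<lambda>(\<omega>, x). fun_upd \<omega> (Suc n) x" and ?C = "\<Sum>k=0..n. c k"
    interpret \<mu>: prob_space ?\<mu> by (rule IP)
    have kP: "P (Suc n) \<in> Omega X n \<rightarrow>\<^sub>M prob_algebra (X (Suc n))"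
      and kQ: "Q (Suc n) \<in> Omega Y n \<rightarrow>\<^sub>M prob_algebra (Y (Suc n))"
      using P[of "Suc n"] Q[of "Suc n"] by auto
    have spO: "space (Omega X n) = space (Omega Y n)"
      using subO[of n] by (simp add: subalgebra_def)
    have KP: "prob_space (P (Suc n) \<omega>)" "space (P (Suc n) \<omega>) = space (Y (Suc n))"
      "sets (Y (Suc n)) \<subseteq> sets (P (Suc n) \<omega>)"
      and KQ: "prob_space (Q (Suc n) \<omega>)" "space (Q (Suc n) \<omega>) = space (Y (Suc n))"
      "sets (Y (Suc n)) \<subseteq> sets (Q (Suc n) \<omega>)"
      and ctv: "tv_dist (Y (Suc n)) (P (Suc n) \<omega>) (Q (Suc n) \<omega>) \<le> c (Suc n)"
      if \<omega>: "\<omega> \<in> space (Omega Y n)" for \<omega>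
    proof -
      show "prob_space (P (Suc n) \<omega>)" "space (P (Suc n) \<omega>) = space (Y (Suc n))"
        "sets (Y (Suc n)) \<subseteq> sets (P (Suc n) \<omega>)"
        using measurable_space[OF kP, of \<omega>] \<omega> spO sub[of "Suc n"]
        by (auto simp: space_prob_algebra subalgebra_def dest: sets_eq_imp_space_eq)
      show "prob_space (Q (Suc n) \<omega>)" "space (Q (Suc n) \<omega>) = space (Y (Suc n))"
        "sets (Y (Suc n)) \<subseteq> sets (Q (Suc n) \<omega>)"
        using measurable_space[OF kQ \<omega>]
        by (auto simp: space_prob_algebra dest: sets_eq_imp_space_eq)
      \<comment> \<open>The supremum runs over \<open>space (Omega X n)\<close>, which is the same
        carrier as \<open>space (Omega Y n)\<close> by \<open>spO\<close>.\<close>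
      have "tv_dist (Y (Suc n)) (P (Suc n) \<omega>) (Q (Suc n) \<omega>)
          \<le> kernel_tv_dist (Omega X n) (Y (Suc n)) (P (Suc n)) (Q (Suc n))"
        using \<omega> spO measurable_space[OF kP] measurable_space[OF kQ]
        by (intro tv_dist_le_kernel_tv_dist[OF _ sub]) auto
      also have "\<dots> \<le> c (Suc n)"
        using c[of "Suc n"] by simp
      finally show "tv_dist (Y (Suc n)) (P (Suc n) \<omega>) (Q (Suc n) \<omega>) \<le> c (Suc n)" .
    qed
    \<comment> \<open>Nonnegativity of the bounds is derived from that of the distances. It is
      required for the return from \<open>ennreal\<close> to the reals at the end.\<close>
    have C0: "0 \<le> ?C"
      using Suc.IH tv_dist_nonneg[OF IP IQ, of n] by linarith
    \<comment> \<open>A probability measure lives on a nonempty space, so some kernel pair is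
      available to show \<open>0 \<le> c (Suc n)\<close>.\<close>
    obtain \<omega>0 where \<omega>0: "\<omega>0 \<in> space (Omega Y n)"
      using \<mu>.not_empty unfolding IP(2) by blast
    have c0': "0 \<le> c (Suc n)"
      using tv_dist_nonneg[OF KP[OF \<omega>0] KQ[OF \<omega>0]] ctv[OF \<omega>0] by linarith
    show ?case
    proof (rule tv_dist_leI[OF IP IQ])
      fix A assume A: "A \<in> sets (Omega Y (Suc n))"
      then have AX: "A \<in> sets (Omega X (Suc n))"
        using subO[of "Suc n"] by (auto simp: subalgebra_def)
      define A' where "A' = ?f -` A \<inter> space (Omega Y n \<Otimes>\<^sub>M Y (Suc n))"
      \<comment> \<open>The carriers agree, so a single set \<open>A'\<close> serves in the section
        formulas of both products.\<close>
      have A'X: "A' = ?f -` A \<inter> space (Omega X n \<Otimes>\<^sub>M X (Suc n))"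
        using sub[of "Suc n"] spO by (auto simp: A'_def space_pair_measure subalgebra_def)
      have "?f \<in> Omega Y n \<Otimes>\<^sub>M Y (Suc n) \<rightarrow>\<^sub>M Omega Y (Suc n)"
        unfolding atMost_Suc by (rule measurable_add_dim)
      then have A': "A' \<in> sets (Omega Y n \<Otimes>\<^sub>M Y (Suc n))"
        using measurable_sets[OF _ A] by (simp add: A'_def)
      define g where "g \<omega> = measure (Q (Suc n) \<omega>) (Pair \<omega> -` A')" for \<omega>
      have g[measurable]: "g \<in> borel_measurable (Omega Y n)"
        using kernel_section_measurable[OF kQ A'] by (simp add: g_def[abs_def] measure_def)
      have gm: "g \<in> borel_measurable ?\<mu>"
        using measurable_from_subalg[OF _ g] IP[of n] by (auto simp: subalgebra_def)
      have eg: "emeasure (Q (Suc n) \<omega>) (Pair \<omega> -` A') = ennreal (g \<omega>)"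
        if "\<omega> \<in> space (Omega Y n)" for \<omega>
        using KQ(1)[OF that] by (simp add: g_def finite_measure.emeasure_eq_measure prob_space.finite_measure)
      have "emeasure (iter_kernel_prod X P0 P (Suc n)) A =
          (\<integral>\<^sup>+\<omega>. emeasure (P (Suc n) \<omega>) (Pair \<omega> -` A') \<partial>?\<mu>)"
        unfolding A'X by (rule emeasure_iter_kernel_prod_Suc[OF P0 P AX])
      also have "\<dots> \<le> (\<integral>\<^sup>+\<omega>. ennreal (g \<omega>) + ennreal (c (Suc n) / 2) \<partial>?\<mu>)"
      proof (rule nn_integral_mono)
        fix \<omega> assume "\<omega> \<in> space ?\<mu>"
        then have \<omega>: "\<omega> \<in> space (Omega Y n)"
          using IP(2)[of n] by simp
        \<comment> \<open>The section of \<open>A'\<close> at \<open>\<omega>\<close> lies in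
          \<open>Y (Suc n)\<close>, so the kernel distance bounds the difference there.\<close>
        show "emeasure (P (Suc n) \<omega>) (Pair \<omega> -` A') \<le> ennreal (g \<omega>) + ennreal (c (Suc n) / 2)"
          using emeasure_le_add_tv_dist[OF KP[OF \<omega>] KQ[OF \<omega>] ctv[OF \<omega>] sets_Pair1[OF A', of \<omega>]] eg[OF \<omega>]
          by simp
      qed
      also have "\<dots> = (\<integral>\<^sup>+\<omega>. ennreal (g \<omega>) \<partial>?\<mu>) + ennreal (c (Suc n) / 2)"
        using gm by (subst nn_integral_add) (auto simp: \<mu>.emeasure_space_1)
      \<comment> \<open>Only the base measure changes here. The induction hypothesis controls it on
        \<open>Omega Y n\<close>, for which \<open>g\<close> is measurable.\<close>
      also have "(\<integral>\<^sup>+\<omega>. ennreal (g \<omega>) \<partial>?\<mu>) \<le> (\<integral>\<^sup>+\<omega>. ennreal (g \<omega>) \<partial>?\<nu>) + ennreal (?C / 2)"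
      proof (rule nn_integral_le_add_const[OF IP IQ _ g])
        fix B assume "B \<in> sets (Omega Y n)"
        then show "emeasure ?\<mu> B \<le> emeasure ?\<nu> B + ennreal (?C / 2)"
          by (rule emeasure_le_add_tv_dist[OF IP IQ Suc.IH])
      qed (auto simp: g_def prob_space.prob_le_1[OF KQ(1)])
      also have "(\<integral>\<^sup>+\<omega>. ennreal (g \<omega>) \<partial>?\<nu>) = (\<integral>\<^sup>+\<omega>. emeasure (Q (Suc n) \<omega>) (Pair \<omega> -` A') \<partial>?\<nu>)"
        using eg IQ(2)[of n] by (intro nn_integral_cong) auto
      also have "\<dots> = emeasure (iter_kernel_prod Y Q0 Q (Suc n)) A"
        unfolding A'_def by (rule emeasure_iter_kernel_prod_Suc[OF Q0 Q A, symmetric])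
      finally have "emeasure (iter_kernel_prod X P0 P (Suc n)) A
          \<le> emeasure (iter_kernel_prod Y Q0 Q (Suc n)) A + ennreal (?C / 2) + ennreal (c (Suc n) / 2)"
        by (simp add: add_right_mono)
      then have "ennreal (measure (iter_kernel_prod X P0 P (Suc n)) A)
          \<le> ennreal (measure (iter_kernel_prod Y Q0 Q (Suc n)) A + ?C / 2 + c (Suc n) / 2)"
        using C0 c0' IP(1)[of "Suc n"] IQ(1)[of "Suc n"]
        by (simp del: iter_kernel_prod.simps
            add: finite_measure.emeasure_eq_measure prob_space.finite_measure)
      then show "measure (iter_kernel_prod X P0 P (Suc n)) A
          \<le> measure (iter_kernel_prod Y Q0 Q (Suc n)) A + (\<Sum>k = 0..Suc n. c k) / 2"
        using C0 c0' by (subst (asm) ennreal_le_iff)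
          (simp_all del: iter_kernel_prod.simps add: add_divide_distrib)
    qed
  }
qed

end
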